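(* Let $R$ be a right quasi-continuous and right nonsingular ring. Then $R$ is Rickart (that is, both left and right Rickart).
   Context: Rings are associative with identity. A ring $R$ is right quasi-continuous if the right module $M=R_R$ satisfies (C1) every submodule of $M$ is essential in a direct summand of $M$, and (C3) if $A$ and $B$ are direct summands of $M$ with $A\cap B=0$, then $A\oplus B$ is also a direct summand of $M$. A ring $R$ is right nonsingular if no nonzero element of $R$ has an essential right ideal as its right annihilator. A ring is right (left) Rickart if the right (left) annihilator of each element is generated, as a right (left) ideal, by an idempotent; it is Rickart if it is both left and right Rickart. *)

theory Defs
  imports "HOL-Algebra.Algebra"
begin

section \<open>One-sided ideals\<close>

text \<open>
  The library has only two-sided ideals, and modules only over commutative rings.  The submodules
  of the right module \<open>R\<^sub>R\<close> are exactly the right ideals of \<open>R\<close>, so module-theoretic notions for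
  \<open>R\<^sub>R\<close> are stated below in terms of right ideals.  The zero ring is allowed.
\<close>

locale right_ideal = additive_subgroup I R + ring R for I and R (structure) +
  assumes I_r_closed: "\<lbrakk>a \<in> I; x \<in> carrier R\<rbrakk> \<Longrightarrow> a \<otimes> x \<in> I"

locale left_ideal = additive_subgroup I R + ring R for I and R (structure) +
  assumes I_l_closed: "\<lbrakk>a \<in> I; x \<in> carrier R\<rbrakk> \<Longrightarrow> x \<otimes> a \<in> I"

definition gen_right_ideal :: "('a, 'b) ring_scheme \<Rightarrow> 'a set \<Rightarrow> 'a set"
  where "gen_right_ideal R S = \<Inter>{I. right_ideal I R \<and> S \<subseteq> I}"

definition gen_left_ideal :: "('a, 'b) ring_scheme \<Rightarrow> 'a set \<Rightarrow> 'a set"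
  where "gen_left_ideal R S = \<Inter>{I. left_ideal I R \<and> S \<subseteq> I}"

lemma (in ring) gen_right_ideal_singleton:
  assumes a: "a \<in> carrier R"
  shows "gen_right_ideal R {a} = {a \<otimes> x | x. x \<in> carrier R}"
proof
  have sub: "subgroup {a \<otimes> x | x. x \<in> carrier R} (add_monoid R)"
  proof (rule add.subgroupI)
    show "{a \<otimes> x | x. x \<in> carrier R} \<subseteq> carrier R" using a by auto
    show "{a \<otimes> x | x. x \<in> carrier R} \<noteq> {}" by auto
  next
    fix u assume "u \<in> {a \<otimes> x | x. x \<in> carrier R}"
    then obtain x where "x \<in> carrier R" "u = a \<otimes> x" by auto
    then have "\<ominus> u = a \<otimes> (\<ominus> x)" "\<ominus> x \<in> carrier R" using a by (auto simp: r_minus)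
    then show "\<ominus> u \<in> {a \<otimes> x | x. x \<in> carrier R}" by blast
  next
    fix u v
    assume "u \<in> {a \<otimes> x | x. x \<in> carrier R}" "v \<in> {a \<otimes> x | x. x \<in> carrier R}"
    then obtain x y where "x \<in> carrier R" "u = a \<otimes> x" "y \<in> carrier R" "v = a \<otimes> y" by auto
    then have "u \<oplus> v = a \<otimes> (x \<oplus> y)" "x \<oplus> y \<in> carrier R" using a by (auto simp: r_distr)
    then show "u \<oplus> v \<in> {a \<otimes> x | x. x \<in> carrier R}" by blast
  qed
  have "right_ideal {a \<otimes> x | x. x \<in> carrier R} R"
  proof (intro right_ideal.intro right_ideal_axioms.intro additive_subgroup.intro sub ring_axioms)
    fix u y assume "u \<in> {a \<otimes> x | x. x \<in> carrier R}" and y: "y \<in> carrier R"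
    then obtain x where "x \<in> carrier R" "u = a \<otimes> x" by auto
    then have "u \<otimes> y = a \<otimes> (x \<otimes> y)" "x \<otimes> y \<in> carrier R" using a y by (auto simp: m_assoc)
    then show "u \<otimes> y \<in> {a \<otimes> x | x. x \<in> carrier R}" by blast
  qed
  moreover have "a \<in> {a \<otimes> x | x. x \<in> carrier R}" using a by (auto intro: exI[of _ \<one>])
  ultimately show "gen_right_ideal R {a} \<subseteq> {a \<otimes> x | x. x \<in> carrier R}"
    unfolding gen_right_ideal_def by blast
  show "{a \<otimes> x | x. x \<in> carrier R} \<subseteq> gen_right_ideal R {a}"
    unfolding gen_right_ideal_def by (auto intro: right_ideal.I_r_closed)
qed

lemma (in ring) gen_left_ideal_singleton:
  assumes a: "a \<in> carrier R"
  shows "gen_left_ideal R {a} = {x \<otimes> a | x. x \<in> carrier R}"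
proof
  have sub: "subgroup {x \<otimes> a | x. x \<in> carrier R} (add_monoid R)"
  proof (rule add.subgroupI)
    show "{x \<otimes> a | x. x \<in> carrier R} \<subseteq> carrier R" using a by auto
    show "{x \<otimes> a | x. x \<in> carrier R} \<noteq> {}" by auto
  next
    fix u assume "u \<in> {x \<otimes> a | x. x \<in> carrier R}"
    then obtain x where "x \<in> carrier R" "u = x \<otimes> a" by auto
    then have "\<ominus> u = (\<ominus> x) \<otimes> a" "\<ominus> x \<in> carrier R" using a by (auto simp: l_minus)
    then show "\<ominus> u \<in> {x \<otimes> a | x. x \<in> carrier R}" by blast
  next
    fix u v
    assume "u \<in> {x \<otimes> a | x. x \<in> carrier R}" "v \<in> {x \<otimes> a | x. x \<in> carrier R}"
    then obtain x y where "x \<in> carrier R" "u = x \<otimes> a" "y \<in> carrier R" "v = y \<otimes> a" by auto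
    then have "u \<oplus> v = (x \<oplus> y) \<otimes> a" "x \<oplus> y \<in> carrier R" using a by (auto simp: l_distr)
    then show "u \<oplus> v \<in> {x \<otimes> a | x. x \<in> carrier R}" by blast
  qed
  have "left_ideal {x \<otimes> a | x. x \<in> carrier R} R"
  proof (intro left_ideal.intro left_ideal_axioms.intro additive_subgroup.intro sub ring_axioms)
    fix u y assume "u \<in> {x \<otimes> a | x. x \<in> carrier R}" and y: "y \<in> carrier R"
    then obtain x where "x \<in> carrier R" "u = x \<otimes> a" by auto
    then have "y \<otimes> u = (y \<otimes> x) \<otimes> a" "y \<otimes> x \<in> carrier R" using a y by (auto simp: m_assoc)
    then show "y \<otimes> u \<in> {x \<otimes> a | x. x \<in> carrier R}" by blast
  qed
  moreover have "a \<in> {x \<otimes> a | x. x \<in> carrier R}" using a by (auto intro: exI[of _ \<one>])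
  ultimately show "gen_left_ideal R {a} \<subseteq> {x \<otimes> a | x. x \<in> carrier R}"
    unfolding gen_left_ideal_def by blast
  show "{x \<otimes> a | x. x \<in> carrier R} \<subseteq> gen_left_ideal R {a}"
    unfolding gen_left_ideal_def by (auto intro: left_ideal.I_l_closed)
qed

section \<open>Quasi-continuous, nonsingular and Rickart rings\<close>

definition essential_in :: "('a, 'b) ring_scheme \<Rightarrow> 'a set \<Rightarrow> 'a set \<Rightarrow> bool"
  where "essential_in R N K \<longleftrightarrow>
    right_ideal N R \<and> right_ideal K R \<and> N \<subseteq> K \<and>
    (\<forall>L. right_ideal L R \<longrightarrow> L \<subseteq> K \<longrightarrow> N \<inter> L = {\<zero>\<^bsub>R\<^esub>} \<longrightarrow> L = {\<zero>\<^bsub>R\<^esub>})"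

definition direct_summand :: "('a, 'b) ring_scheme \<Rightarrow> 'a set \<Rightarrow> bool"
  where "direct_summand R A \<longleftrightarrow>
    right_ideal A R \<and>
    (\<exists>B. right_ideal B R \<and> A \<inter> B = {\<zero>\<^bsub>R\<^esub>} \<and> A <+>\<^bsub>R\<^esub> B = carrier R)"

definition condition_C1 :: "('a, 'b) ring_scheme \<Rightarrow> bool"
  where "condition_C1 R \<longleftrightarrow>
    (\<forall>N. right_ideal N R \<longrightarrow> (\<exists>A. direct_summand R A \<and> essential_in R N A))"

definition condition_C3 :: "('a, 'b) ring_scheme \<Rightarrow> bool"
  where "condition_C3 R \<longleftrightarrow>
    (\<forall>A B. direct_summand R A \<longrightarrow> direct_summand R B \<longrightarrow> A \<inter> B = {\<zero>\<^bsub>R\<^esub>} \<longrightarrow>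
      direct_summand R (A <+>\<^bsub>R\<^esub> B))"

definition right_quasi_continuous :: "('a, 'b) ring_scheme \<Rightarrow> bool"
  where "right_quasi_continuous R \<longleftrightarrow> condition_C1 R \<and> condition_C3 R"

definition right_annihilator :: "('a, 'b) ring_scheme \<Rightarrow> 'a \<Rightarrow> 'a set"
  where "right_annihilator R a = {x \<in> carrier R. a \<otimes>\<^bsub>R\<^esub> x = \<zero>\<^bsub>R\<^esub>}"

definition left_annihilator :: "('a, 'b) ring_scheme \<Rightarrow> 'a \<Rightarrow> 'a set"
  where "left_annihilator R a = {x \<in> carrier R. x \<otimes>\<^bsub>R\<^esub> a = \<zero>\<^bsub>R\<^esub>}"

definition right_nonsingular :: "('a, 'b) ring_scheme \<Rightarrow> bool"
  where "right_nonsingular R \<longleftrightarrow>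
    \<not> (\<exists>a \<in> carrier R. a \<noteq> \<zero>\<^bsub>R\<^esub> \<and> essential_in R (right_annihilator R a) (carrier R))"

definition right_Rickart :: "('a, 'b) ring_scheme \<Rightarrow> bool"
  where "right_Rickart R \<longleftrightarrow>
    (\<forall>a \<in> carrier R. \<exists>e \<in> carrier R.
      e \<otimes>\<^bsub>R\<^esub> e = e \<and> right_annihilator R a = gen_right_ideal R {e})"

definition left_Rickart :: "('a, 'b) ring_scheme \<Rightarrow> bool"
  where "left_Rickart R \<longleftrightarrow>
    (\<forall>a \<in> carrier R. \<exists>e \<in> carrier R.
      e \<otimes>\<^bsub>R\<^esub> e = e \<and> left_annihilator R a = gen_left_ideal R {e})"

definition Rickart :: "('a, 'b) ring_scheme \<Rightarrow> bool"
  where "Rickart R \<longleftrightarrow> left_Rickart R \<and> right_Rickart R"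

end

theory Submission
  imports Defs
begin

text \<open>
  By (C1) every right ideal \<open>N\<close> is essential in some \<open>e R\<close> with \<open>e\<close> idempotent.  Right
  nonsingularity means that such an essential extension is invisible to left multiplication: if
  \<open>c N = 0\<close> then \<open>c e R = 0\<close>, because for \<open>x \<in> e R\<close> the element \<open>c x\<close> is killed by
  \<open>{r. x r \<in> N}\<close>, which is an essential right ideal (lemma \<open>essential_left_mult_zero\<close>).

  Both Rickart conditions are instances of this.  For \<open>N\<close> the right annihilator of \<open>a\<close>, take
  \<open>c = a\<close>: then \<open>a e R = 0\<close>, so \<open>N\<close> is all of \<open>e R\<close>.  For \<open>N = a R\<close>, let \<open>c\<close> range over the left
  annihilator of \<open>a\<close>: then \<open>c a = 0\<close> forces \<open>c e = 0\<close>, while \<open>e a = a\<close> gives the converse, so \<open>a\<close>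
  and \<open>e\<close> have the same left annihilator, which is \<open>R (1 - e)\<close>.
\<close>

lemma (in ring) right_idealI:
  assumes "I \<subseteq> carrier R" and "\<zero> \<in> I"
    and "\<And>u v. \<lbrakk>u \<in> I; v \<in> I\<rbrakk> \<Longrightarrow> u \<oplus> v \<in> I"
    and mult: "\<And>u r. \<lbrakk>u \<in> I; r \<in> carrier R\<rbrakk> \<Longrightarrow> u \<otimes> r \<in> I"
  shows "right_ideal I R"
proof -
  have "subgroup I (add_monoid R)"
  proof (rule add.subgroupI)
    fix u assume u: "u \<in> I"
    then have "u \<in> carrier R" using assms(1) by auto
    then have "u \<otimes> (\<ominus> \<one>) = \<ominus> u" by (simp add: r_minus)
    then show "\<ominus> u \<in> I" using mult[OF u, of "\<ominus> \<one>"] by simp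
  qed (use assms in auto)
  then show ?thesis
    by (intro right_ideal.intro right_ideal_axioms.intro additive_subgroup.intro
        ring_axioms mult)
qed

lemma right_ideal_closed:
  assumes "right_ideal I R"
  shows "I \<subseteq> carrier R" and "\<zero>\<^bsub>R\<^esub> \<in> I"
    and "\<lbrakk>u \<in> I; v \<in> I\<rbrakk> \<Longrightarrow> u \<oplus>\<^bsub>R\<^esub> v \<in> I"
    and "\<lbrakk>u \<in> I; r \<in> carrier R\<rbrakk> \<Longrightarrow> u \<otimes>\<^bsub>R\<^esub> r \<in> I"
proof -
  interpret right_ideal I R by fact
  show "I \<subseteq> carrier R" by (rule a_subset)
  show "\<zero>\<^bsub>R\<^esub> \<in> I" by (rule additive_subgroup.zero_closed[OF additive_subgroup_axioms])
  show "\<lbrakk>u \<in> I; v \<in> I\<rbrakk> \<Longrightarrow> u \<oplus>\<^bsub>R\<^esub> v \<in> I" by (rule additive_subgroup.a_closed[OF additive_subgroup_axioms])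
  show "\<lbrakk>u \<in> I; r \<in> carrier R\<rbrakk> \<Longrightarrow> u \<otimes>\<^bsub>R\<^esub> r \<in> I" by (rule I_r_closed)
qed

lemma (in ring) right_ideal_carrier: "right_ideal (carrier R) R"
  by (rule right_idealI) auto

lemma (in ring) right_ideal_left_translate:
  assumes L: "right_ideal L R" and x: "x \<in> carrier R"
  shows "right_ideal ((\<otimes>) x ` L) R"
proof (rule right_idealI)
  note cl = right_ideal_closed[OF L]
  show "(\<otimes>) x ` L \<subseteq> carrier R" using cl(1) x by auto
  show "\<zero> \<in> (\<otimes>) x ` L" using cl(2) x by (auto intro!: image_eqI[of _ _ \<zero>])
  show "u \<oplus> v \<in> (\<otimes>) x ` L" if uv: "u \<in> (\<otimes>) x ` L" "v \<in> (\<otimes>) x ` L" for u v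
  proof -
    obtain l m where lm: "l \<in> L" "m \<in> L" "u = x \<otimes> l" "v = x \<otimes> m" using uv by auto
    then have "u \<oplus> v = x \<otimes> (l \<oplus> m)" using cl(1) x by (simp add: r_distr subset_iff)
    then show ?thesis using cl(3) lm by blast
  qed
  show "u \<otimes> r \<in> (\<otimes>) x ` L" if ur: "u \<in> (\<otimes>) x ` L" "r \<in> carrier R" for u r
  proof -
    obtain l where l: "l \<in> L" "u = x \<otimes> l" using ur by auto
    then have "u \<otimes> r = x \<otimes> (l \<otimes> r)" using cl(1) x ur by (simp add: m_assoc subset_iff)
    then show ?thesis using cl(4) l ur by blast
  qed
qed

lemma (in ring) right_ideal_quotient:
  assumes N: "right_ideal N R" and x: "x \<in> carrier R"
  shows "right_ideal {r \<in> carrier R. x \<otimes> r \<in> N} R"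
proof (rule right_idealI)
  note cl = right_ideal_closed[OF N]
  show "\<zero> \<in> {r \<in> carrier R. x \<otimes> r \<in> N}" using cl(2) x by simp
  show "u \<oplus> v \<in> {r \<in> carrier R. x \<otimes> r \<in> N}"
    if "u \<in> {r \<in> carrier R. x \<otimes> r \<in> N}" "v \<in> {r \<in> carrier R. x \<otimes> r \<in> N}" for u v
    using that cl(3) x by (simp add: r_distr)
  show "u \<otimes> r \<in> {r \<in> carrier R. x \<otimes> r \<in> N}"
    if "u \<in> {r \<in> carrier R. x \<otimes> r \<in> N}" "r \<in> carrier R" for u r
    using that cl(4)[of "x \<otimes> u" r] x by (simp add: m_assoc)
qed auto

lemma (in ring) right_ideal_right_annihilator:
  assumes a: "a \<in> carrier R"
  shows "right_ideal (right_annihilator R a) R"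
proof -
  have "right_ideal {\<zero>} R" by (rule right_idealI) auto
  from right_ideal_quotient[OF this a] show ?thesis
    by (simp add: right_annihilator_def)
qed

text \<open>
  A right ideal \<open>L\<close> meeting \<open>{r. x r \<in> N}\<close> trivially has \<open>x L\<close> meeting \<open>N\<close> trivially, so \<open>x L = 0\<close>
  by essentiality; but then \<open>L\<close> lies in \<open>{r. x r \<in> N}\<close> and must itself vanish.
\<close>

lemma (in ring) essential_quotient:
  assumes NK: "essential_in R N K" and x: "x \<in> K"
  shows "essential_in R {r \<in> carrier R. x \<otimes> r \<in> N} (carrier R)"
proof -
  let ?Q = "{r \<in> carrier R. x \<otimes> r \<in> N}"
  have N: "right_ideal N R" and K: "right_ideal K R"
    using NK by (auto simp: essential_in_def)
  have ess: "L = {\<zero>}" if "right_ideal L R" "L \<subseteq> K" "N \<inter> L = {\<zero>}" for L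
    using NK that by (auto simp: essential_in_def)
  have xR: "x \<in> carrier R" using right_ideal_closed(1)[OF K] x by auto
  have "L = {\<zero>}" if L: "right_ideal L R" and QL: "?Q \<inter> L = {\<zero>}" for L
  proof -
    note Lcl = right_ideal_closed[OF L]
    have xL: "right_ideal ((\<otimes>) x ` L) R"
      by (rule right_ideal_left_translate[OF L xR])
    have "N \<inter> (\<otimes>) x ` L \<subseteq> {\<zero>}"
    proof
      fix y assume "y \<in> N \<inter> (\<otimes>) x ` L"
      then obtain l where "l \<in> L" "y = x \<otimes> l" "y \<in> N" by auto
      moreover from this have "l \<in> ?Q \<inter> L" using Lcl(1) by auto
      ultimately show "y \<in> {\<zero>}" using QL xR by auto
    qed
    then have "N \<inter> (\<otimes>) x ` L = {\<zero>}"
      using right_ideal_closed(2)[OF N] right_ideal_closed(2)[OF xL] by auto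
    moreover have "(\<otimes>) x ` L \<subseteq> K"
      using right_ideal_closed(4)[OF K x] Lcl(1) by auto
    ultimately have "(\<otimes>) x ` L = {\<zero>}" using ess xL by blast
    then have "x \<otimes> l = \<zero>" if "l \<in> L" for l using that by blast
    then have "L \<subseteq> ?Q" using Lcl(1) right_ideal_closed(2)[OF N] by auto
    then show ?thesis using QL by auto
  qed
  then show ?thesis
    using right_ideal_quotient[OF N xR] right_ideal_carrier by (auto simp: essential_in_def)
qed

lemma (in ring) essential_in_carrier_mono:
  assumes "essential_in R I (carrier R)" and "I \<subseteq> J" and J: "right_ideal J R"
  shows "essential_in R J (carrier R)"
  unfolding essential_in_def
proof (intro conjI allI impI)
  fix L assume L: "right_ideal L R" "L \<subseteq> carrier R" "J \<inter> L = {\<zero>}"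
  have "right_ideal I R" using assms(1) by (simp add: essential_in_def)
  then have "I \<inter> L = {\<zero>}"
    using L assms(2) right_ideal_closed(2)[of I R] right_ideal_closed(2)[OF L(1)] by auto
  then show "L = {\<zero>}" using assms(1) L by (simp add: essential_in_def)
qed (use J right_ideal_carrier right_ideal_closed(1)[OF J] in auto)

text \<open>
  The right annihilator of \<open>c x\<close> contains \<open>{r. x r \<in> N}\<close>, hence is essential, so \<open>c x\<close> is zero by
  nonsingularity.  Applied to differences, this says that left multiplication on an essential
  extension of \<open>N\<close> is determined by its restriction to \<open>N\<close>.
\<close>

lemma (in ring) essential_left_mult_zero:
  assumes ns: "right_nonsingular R" and NK: "essential_in R N K"
    and c: "c \<in> carrier R" and cN: "\<And>n. n \<in> N \<Longrightarrow> c \<otimes> n = \<zero>" and x: "x \<in> K"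
  shows "c \<otimes> x = \<zero>"
proof -
  have "right_ideal K R" using NK by (simp add: essential_in_def)
  then have xR: "x \<in> carrier R" using right_ideal_closed(1) x by blast
  have "{r \<in> carrier R. x \<otimes> r \<in> N} \<subseteq> right_annihilator R (c \<otimes> x)"
    using cN c xR by (auto simp: right_annihilator_def m_assoc)
  then have "essential_in R (right_annihilator R (c \<otimes> x)) (carrier R)"
    using essential_in_carrier_mono essential_quotient[OF NK x]
      right_ideal_right_annihilator c xR by simp
  then show ?thesis using ns c xR by (auto simp: right_nonsingular_def)
qed

text \<open>
  The idempotent is the \<open>A\<close>-component of \<open>\<one>\<close>: multiplying \<open>\<one> = e + f\<close> on the right by \<open>x \<in> A\<close>
  exhibits \<open>x - e x = f x\<close> as an element of \<open>A \<inter> B\<close>.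
\<close>

lemma (in ring) direct_summand_idempotent:
  assumes "direct_summand R A"
  obtains e where "e \<in> carrier R" "e \<otimes> e = e" "A = gen_right_ideal R {e}"
    "\<And>x. x \<in> A \<Longrightarrow> e \<otimes> x = x"
proof -
  obtain B where A: "right_ideal A R" and B: "right_ideal B R"
    and AB: "A \<inter> B = {\<zero>}" and sum: "A <+> B = carrier R"
    using assms by (auto simp: direct_summand_def)
  note Acl = right_ideal_closed[OF A] and Bcl = right_ideal_closed[OF B]
  have "\<one> \<in> A <+> B" using sum by simp
  then obtain e f where e: "e \<in> A" and f: "f \<in> B" and ef: "\<one> = e \<oplus> f"
    by (auto simp: set_add_def')
  have eR: "e \<in> carrier R" and fR: "f \<in> carrier R" using Acl(1) Bcl(1) e f by auto
  have fix_A: "e \<otimes> x = x" if x: "x \<in> A" for x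
  proof -
    have xR: "x \<in> carrier R" using Acl(1) x by auto
    have split: "e \<otimes> x \<oplus> f \<otimes> x = x"
      using l_distr[OF eR fR xR] xR by (simp add: ef[symmetric])
    have "e \<otimes> (\<ominus> x) \<oplus> x = \<ominus> (e \<otimes> x) \<oplus> (e \<otimes> x \<oplus> f \<otimes> x)"
      using eR xR by (simp add: split r_minus)
    also have "\<dots> = f \<otimes> x" using eR fR xR by (simp add: r_neg1)
    finally have "f \<otimes> x \<in> A"
      using Acl(3)[OF Acl(4)[OF e, of "\<ominus> x"] x] xR by simp
    moreover have "f \<otimes> x \<in> B" using Bcl(4)[OF f xR] .
    ultimately have "f \<otimes> x = \<zero>" using AB by auto
    with split show ?thesis using eR xR by simp
  qed
  have "A = gen_right_ideal R {e}"
    unfolding gen_right_ideal_singleton[OF eR]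
  proof
    show "A \<subseteq> {e \<otimes> x |x. x \<in> carrier R}" using fix_A Acl(1) by force
    show "{e \<otimes> x |x. x \<in> carrier R} \<subseteq> A" using Acl(4)[OF e] by auto
  qed
  then show ?thesis using that eR fix_A[OF e] fix_A by blast
qed

lemma (in ring) C1_essential_idempotent:
  assumes "condition_C1 R" and "right_ideal N R"
  obtains e where "e \<in> carrier R" "e \<otimes> e = e" "essential_in R N (gen_right_ideal R {e})"
    "\<And>x. x \<in> gen_right_ideal R {e} \<Longrightarrow> e \<otimes> x = x"
proof -
  obtain A where "direct_summand R A" "essential_in R N A"
    using assms by (auto simp: condition_C1_def)
  with that show ?thesis by (metis direct_summand_idempotent)
qed

lemma (in ring) C1_nonsingular_imp_right_Rickart:
  assumes C1: "condition_C1 R" and ns: "right_nonsingular R"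
  shows "right_Rickart R"
  unfolding right_Rickart_def
proof
  fix a assume a: "a \<in> carrier R"
  let ?N = "right_annihilator R a"
  obtain e where e: "e \<in> carrier R" "e \<otimes> e = e"
    and ess: "essential_in R ?N (gen_right_ideal R {e})"
    using C1_essential_idempotent[OF C1 right_ideal_right_annihilator[OF a]] by metis
  have "gen_right_ideal R {e} \<subseteq> ?N"
  proof
    fix x assume x: "x \<in> gen_right_ideal R {e}"
    have "a \<otimes> x = \<zero>"
      by (rule essential_left_mult_zero[OF ns ess a _ x]) (simp add: right_annihilator_def)
    then show "x \<in> ?N"
      using x e(1) by (auto simp: right_annihilator_def gen_right_ideal_singleton)
  qed
  moreover have "?N \<subseteq> gen_right_ideal R {e}" using ess by (simp add: essential_in_def)
  ultimately show "\<exists>e\<in>carrier R. e \<otimes> e = e \<and> ?N = gen_right_ideal R {e}"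
    using e by blast
qed

lemma (in ring) left_annihilator_idempotent:
  assumes e: "e \<in> carrier R" "e \<otimes> e = e"
  shows "(\<one> \<ominus> e) \<otimes> (\<one> \<ominus> e) = \<one> \<ominus> e"
    and "left_annihilator R e = gen_left_ideal R {\<one> \<ominus> e}"
proof -
  have 0: "(\<one> \<ominus> e) \<otimes> e = \<zero>"
    using e by (simp add: minus_eq l_distr l_minus r_neg)
  show "(\<one> \<ominus> e) \<otimes> (\<one> \<ominus> e) = \<one> \<ominus> e"
    using e 0 by (simp add: minus_eq r_distr r_minus)
  show "left_annihilator R e = gen_left_ideal R {\<one> \<ominus> e}"
  proof
    show "left_annihilator R e \<subseteq> gen_left_ideal R {\<one> \<ominus> e}"
    proof
      fix c assume "c \<in> left_annihilator R e"
      then have c: "c \<in> carrier R" "c \<otimes> e = \<zero>" by (auto simp: left_annihilator_def)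
      then have "c = c \<otimes> (\<one> \<ominus> e)" using e by (simp add: minus_eq r_distr r_minus)
      then show "c \<in> gen_left_ideal R {\<one> \<ominus> e}"
        using c e by (auto simp: gen_left_ideal_singleton)
    qed
    show "gen_left_ideal R {\<one> \<ominus> e} \<subseteq> left_annihilator R e"
      using e 0 by (auto simp: gen_left_ideal_singleton left_annihilator_def m_assoc)
  qed
qed

lemma (in ring) C1_nonsingular_imp_left_Rickart:
  assumes C1: "condition_C1 R" and ns: "right_nonsingular R"
  shows "left_Rickart R"
  unfolding left_Rickart_def
proof
  fix a assume a: "a \<in> carrier R"
  let ?N = "gen_right_ideal R {a}"
  have "?N = (\<otimes>) a ` carrier R" using a by (auto simp: gen_right_ideal_singleton)
  then have N: "right_ideal ?N R"
    using right_ideal_left_translate[OF right_ideal_carrier a] by simp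
  obtain e where e: "e \<in> carrier R" "e \<otimes> e = e"
    and ess: "essential_in R ?N (gen_right_ideal R {e})"
    and fix_e: "\<And>x. x \<in> gen_right_ideal R {e} \<Longrightarrow> e \<otimes> x = x"
    using C1_essential_idempotent[OF C1 N] by metis
  have a_in: "a \<in> ?N" and e_in: "e \<in> gen_right_ideal R {e}"
    by (auto simp: gen_right_ideal_def)
  have ea: "e \<otimes> a = a" using fix_e a_in ess by (auto simp: essential_in_def)
  have "left_annihilator R a = left_annihilator R e"
  proof
    show "left_annihilator R a \<subseteq> left_annihilator R e"
    proof
      fix c assume "c \<in> left_annihilator R a"
      then have c: "c \<in> carrier R" "c \<otimes> a = \<zero>" by (auto simp: left_annihilator_def)
      have "c \<otimes> n = \<zero>" if n: "n \<in> ?N" for n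
      proof -
        obtain r where "r \<in> carrier R" "n = a \<otimes> r"
          using n a by (auto simp: gen_right_ideal_singleton)
        then show ?thesis using c a by (simp add: m_assoc[symmetric])
      qed
      then have "c \<otimes> e = \<zero>"
        using essential_left_mult_zero[OF ns ess c(1) _ e_in] by blast
      then show "c \<in> left_annihilator R e" using c by (simp add: left_annihilator_def)
    qed
    show "left_annihilator R e \<subseteq> left_annihilator R a"
    proof
      fix c assume "c \<in> left_annihilator R e"
      then have c: "c \<in> carrier R" "c \<otimes> e = \<zero>" by (auto simp: left_annihilator_def)
      have "c \<otimes> a = (c \<otimes> e) \<otimes> a" using m_assoc[OF c(1) e(1) a] ea by simp
      then show "c \<in> left_annihilator R a" using c a by (simp add: left_annihilator_def)
    qed
  qed
  then show "\<exists>f\<in>carrier R. f \<otimes> f = f \<and> left_annihilator R a = gen_left_ideal R {f}"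
    using left_annihilator_idempotent[OF e] e
    by (intro bexI[of _ "\<one> \<ominus> e"]) auto
qed

theorem corollary3p4:
  fixes R (structure)
  assumes "ring R"
    and "right_quasi_continuous R"
    and "right_nonsingular R"
  shows "Rickart R"
proof -
  interpret ring R by fact
  have "condition_C1 R" using assms(2) by (simp add: right_quasi_continuous_def)
  then show ?thesis
    using assms(3) C1_nonsingular_imp_left_Rickart C1_nonsingular_imp_right_Rickart
    by (simp add: Rickart_def)
qed

end
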